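(* Let $X$ be a non-empty set and let $\eta: X\times X\to [0,\infty]$ be a function satisfying $(\mathcal{A}_2)$ and $(\mathcal{A}_4)$. Consider a point $x \in X$ and a function $\varphi: X \to [0,\infty]$ such that $\eta(x,x) < \infty$ and $0 < \varphi(x) < \infty$. Assume that for each $u \in X$ and each sequence $(u_k)_{k \in \mathbb{N}}$ in $X$ such that $(\varphi(u_{k}))_{k \in \mathbb{N}}$ is strictly decreasing and $\eta(u,u_k) \to 0$ as $k \to \infty$ we have $$\varphi(u) \leq \lim_{k \to \infty} \varphi(u_k).$$ Then there exists a point $u \in X$ such that $\varphi(u) + \eta(u,x) \leq \varphi(x) + \eta(x,x)$ and $$\varphi(u') + \eta(u',u) \geq \varphi(u) \quad \mbox{for every } u'\in X.$$
   Context: For a function $\eta: X\times X\to[0,\infty]$: $(\mathcal{A}_2)$ means that $\eta(u,x)\leq \eta(u,z)+\eta(z,x)$ whenever $u,x,z\in X$; $(\mathcal{A}_4)$ means that for each sequence $(u_k)_{k \in \mathbb{N}}$ in $X$ such that for each $\varepsilon>0$ there is an index $k_0=k_0(\varepsilon)$ with $\eta(u_j,u_k)<\varepsilon$ for all $j,k \in\mathbb{N}$ with $k_0\leq k<j$, there is a point $u\in X$ such that $\eta(u,u_k) \to 0$ as $k\to \infty$. *)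

theory Defs
  imports "HOL-Library.Extended_Nonnegative_Real"
begin

definition A2 :: "'a set \<Rightarrow> ('a \<Rightarrow> 'a \<Rightarrow> ennreal) \<Rightarrow> bool" where
  "A2 X \<eta> \<longleftrightarrow> (\<forall>u\<in>X. \<forall>x\<in>X. \<forall>z\<in>X. \<eta> u x \<le> \<eta> u z + \<eta> z x)"

text \<open>\<open>\<eta>\<close> need not be symmetric: in both the Cauchy-type condition and the limit,
  the point reached later (respectively the limit) is the first argument.\<close>

definition A4 :: "'a set \<Rightarrow> ('a \<Rightarrow> 'a \<Rightarrow> ennreal) \<Rightarrow> bool" where
  "A4 X \<eta> \<longleftrightarrow>
    (\<forall>s :: nat \<Rightarrow> 'a. range s \<subseteq> X \<longrightarrow>
      (\<forall>\<epsilon>::real. \<epsilon> > 0 \<longrightarrow> (\<exists>k0. \<forall>j k. k0 \<le> k \<and> k < j \<longrightarrow> \<eta> (s j) (s k) < ennreal \<epsilon>)) \<longrightarrow>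
      (\<exists>u\<in>X. (\<lambda>k. \<eta> u (s k)) \<longlonglongrightarrow> 0))"

end

(* Call v an improvement of u when phi v + eta v u < phi u; by the triangle inequality this is
   a transitive relation. If no point reachable from x were optimal, one could build a chain of
   improvements starting at x, choosing the (n+1)-st point almost minimal for phi among the
   improvements of the n-th one. Along the chain phi decreases to its infimum, so the chain is
   Cauchy, and its limit u improves every point of the chain. An improvement of u would again
   improve every point of the chain, so almost minimality forces its phi-value to be at least
   the infimum, hence at least phi u, which is absurd. *)

theory Submission
  imports Defs
begin

definition improvements :: "'a set \<Rightarrow> ('a \<Rightarrow> 'a \<Rightarrow> ennreal) \<Rightarrow> ('a \<Rightarrow> ennreal) \<Rightarrow> 'a \<Rightarrow> 'a set" where
  "improvements X \<eta> \<phi> u = {v \<in> X. \<phi> v + \<eta> v u < \<phi> u}"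

text \<open>The second comparison is only weak because a limit point of a chain inherits its
  inequalities in non-strict form; the strict first comparison keeps the conclusion strict.\<close>

lemma improvements_le_trans:
  assumes "A2 X \<eta>" "u \<in> X" "v \<in> improvements X \<eta> \<phi> u" "w \<in> X" "\<phi> w + \<eta> w v \<le> \<phi> v"
  shows "w \<in> improvements X \<eta> \<phi> u"
proof -
  have v: "v \<in> X" "\<phi> v + \<eta> v u < \<phi> u"
    using assms(3) by (auto simp: improvements_def)
  have "\<eta> w u \<le> \<eta> w v + \<eta> v u"
    using assms(1,2,4) v(1) by (auto simp: A2_def)
  then have "\<phi> w + \<eta> w u \<le> (\<phi> w + \<eta> w v) + \<eta> v u"
    by (simp add: add.assoc add_left_mono)
  also have "\<dots> \<le> \<phi> v + \<eta> v u"
    using assms(5) by (rule add_right_mono)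
  finally show ?thesis
    using v assms(4) by (auto simp: improvements_def)
qed

lemma improvements_trans:
  assumes "A2 X \<eta>" "u \<in> X" "v \<in> improvements X \<eta> \<phi> u" "w \<in> improvements X \<eta> \<phi> v"
  shows "w \<in> improvements X \<eta> \<phi> u"
  using improvements_le_trans[OF assms(1-3), of w] assms(4) by (auto simp: improvements_def)

lemma improvements_less:
  assumes "v \<in> improvements X \<eta> \<phi> u"
  shows "\<phi> v < \<phi> u"
proof -
  have "\<phi> v \<le> \<phi> v + \<eta> v u" by simp
  also have "\<dots> < \<phi> u" using assms by (simp add: improvements_def)
  finally show ?thesis .
qed

lemma improvements_chain:
  fixes s :: "nat \<Rightarrow> 'a"
  assumes "A2 X \<eta>" "range s \<subseteq> X" "\<And>n. s (Suc n) \<in> improvements X \<eta> \<phi> (s n)" "k < j"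
  shows "s j \<in> improvements X \<eta> \<phi> (s k)"
  using \<open>k < j\<close>
proof (induction j rule: less_Suc_induct)
  case (1 i)
  then show ?case by (rule assms(3))
next
  case (2 i j k)
  have "s i \<in> X" using assms(2) by blast
  then show ?case using 2(3,4) by (rule improvements_trans[OF assms(1)])
qed

text \<open>One finite value makes the infimum finite, so adding \<open>e\<close> increases it
  strictly and some value of \<open>\<phi>\<close> on \<open>S\<close> falls below the sum.\<close>

lemma exists_almost_minimizer:
  fixes \<phi> :: "'a \<Rightarrow> ennreal" and e :: ennreal
  assumes "v \<in> S" "\<phi> v < \<infinity>" "0 < e"
  shows "\<exists>w\<in>S. \<forall>v\<in>S. \<phi> w \<le> \<phi> v + e"
proof -
  have "(INF v\<in>S. \<phi> v) \<le> \<phi> v"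
    using assms(1) by (rule INF_lower)
  then have "(INF v\<in>S. \<phi> v) < \<infinity>"
    using assms(2) by (rule le_less_trans)
  then have "(INF v\<in>S. \<phi> v) < (INF v\<in>S. \<phi> v) + e"
    using assms(3) ennreal_add_left_cancel_less[of "INF v\<in>S. \<phi> v" 0 e]
    unfolding infinity_ennreal_def add_0_right less_top by blast
  then obtain w where "w \<in> S" "\<phi> w < (INF v\<in>S. \<phi> v) + e"
    unfolding INF_less_iff by blast
  moreover have "(INF v\<in>S. \<phi> v) + e \<le> \<phi> v + e" if "v \<in> S" for v
    using that by (intro add_right_mono INF_lower)
  ultimately show ?thesis
    by (meson less_imp_le order_trans)
qed

text \<open>Semicontinuity is requested only along \<open>s\<close>, with the infimum in place of
  the limit; the two agree because \<open>\<phi>\<close> decreases along the chain.\<close>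

lemma improvements_chain_limit:
  fixes s :: "nat \<Rightarrow> 'a"
  assumes A2: "A2 X \<eta>" and A4: "A4 X \<eta>"
    and s: "range s \<subseteq> X" and fin: "\<phi> (s 0) < \<infinity>"
    and step: "\<And>n. s (Suc n) \<in> improvements X \<eta> \<phi> (s n)"
    and lsc: "\<And>u. u \<in> X \<Longrightarrow> (\<lambda>k. \<eta> u (s k)) \<longlonglongrightarrow> 0 \<Longrightarrow> \<phi> u \<le> (INF k. \<phi> (s k))"
  shows "\<exists>u\<in>X. \<phi> u \<le> (INF k. \<phi> (s k)) \<and> (\<forall>k. u \<in> improvements X \<eta> \<phi> (s k))"
proof -
  define L where "L = (INF k. \<phi> (s k))"
  have L_le: "L \<le> \<phi> (s k)" for k
    unfolding L_def by (rule INF_lower) simp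
  have L_fin: "L < \<infinity>"
    using L_le fin by (rule le_less_trans)
  have chain: "s j \<in> improvements X \<eta> \<phi> (s k)" if "k < j" for j k
    using A2 s step that by (rule improvements_chain)
  \<comment> \<open>This bounds \<open>\<eta> (s j) (s k)\<close> by the gap between
    \<open>\<phi> (s k)\<close> and \<open>L\<close>, in additive form to avoid subtraction of
    extended reals.\<close>
  have L_add: "L + \<eta> (s j) (s k) \<le> \<phi> (s k)" if "k < j" for j k
  proof -
    have "L + \<eta> (s j) (s k) \<le> \<phi> (s j) + \<eta> (s j) (s k)"
      using L_le by (rule add_right_mono)
    also have "\<dots> \<le> \<phi> (s k)"
      using chain[OF that] by (auto simp: improvements_def less_imp_le)
    finally show ?thesis .
  qed
  have "\<exists>k0. \<forall>j k. k0 \<le> k \<and> k < j \<longrightarrow> \<eta> (s j) (s k) < ennreal \<epsilon>" if "\<epsilon> > 0" for \<epsilon> :: real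
  proof -
    \<comment> \<open>Finiteness of \<open>L\<close> matters here: once \<open>\<phi> (s k0)\<close>
      is within \<epsilon> of \<open>L\<close>, cancelling \<open>L\<close> in \<open>L_add\<close>
      gives the Cauchy bound for all later indices.\<close>
    have "L < L + ennreal \<epsilon>"
      using L_fin that ennreal_add_left_cancel_less[of L 0 "ennreal \<epsilon>"]
      by (simp add: less_top)
    then obtain k0 where k0: "\<phi> (s k0) < L + ennreal \<epsilon>"
      unfolding L_def INF_less_iff by blast
    have "\<eta> (s j) (s k) < ennreal \<epsilon>" if "k0 \<le> k" "k < j" for j k
    proof -
      have "\<phi> (s k) \<le> \<phi> (s k0)"
        using improvements_less[OF chain[of k0 k]] that(1) by (cases "k = k0") auto
      then have "L + \<eta> (s j) (s k) < L + ennreal \<epsilon>"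
        using L_add[OF that(2)] k0 by order
      then show ?thesis by (simp add: ennreal_add_left_cancel_less)
    qed
    then show ?thesis by blast
  qed
  then obtain u where u: "u \<in> X" "(\<lambda>k. \<eta> u (s k)) \<longlonglongrightarrow> 0"
    using A4 s unfolding A4_def by blast
  have \<phi>u: "\<phi> u \<le> L"
    unfolding L_def using u by (rule lsc)
  \<comment> \<open>Detour through \<open>s j\<close> for j > k and let j tend to infinity: the
    error \<open>\<eta> u (s j)\<close> vanishes, but strictness is lost.\<close>
  have weak: "\<phi> u + \<eta> u (s k) \<le> \<phi> (s k)" for k
  proof (rule LIMSEQ_le_const)
    show "(\<lambda>j. \<phi> (s k) + \<eta> u (s j)) \<longlonglongrightarrow> \<phi> (s k)"
      using tendsto_add[OF tendsto_const u(2), of "\<phi> (s k)"] by simp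
    have "\<phi> u + \<eta> u (s k) \<le> \<phi> (s k) + \<eta> u (s j)" if "Suc k \<le> j" for j
    proof -
      have "\<eta> u (s k) \<le> \<eta> u (s j) + \<eta> (s j) (s k)"
        using A2 u(1) s unfolding A2_def by (meson rangeI subsetD)
      then have "\<phi> u + \<eta> u (s k) \<le> L + (\<eta> u (s j) + \<eta> (s j) (s k))"
        using \<phi>u by (rule add_mono[rotated])
      also have "\<dots> = (L + \<eta> (s j) (s k)) + \<eta> u (s j)"
        by (simp add: ac_simps)
      also have "\<dots> \<le> \<phi> (s k) + \<eta> u (s j)"
        using L_add[of k j] that by (intro add_right_mono) simp
      finally show ?thesis .
    qed
    then show "\<exists>N. \<forall>n\<ge>N. \<phi> u + \<eta> u (s k) \<le> \<phi> (s k) + \<eta> u (s n)"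
      by blast
  qed
  \<comment> \<open>Strictness returns by going through \<open>s (Suc k)\<close>, which improves
    \<open>s k\<close> strictly and is itself weakly improved by \<open>u\<close>.\<close>
  have "u \<in> improvements X \<eta> \<phi> (s k)" for k
    using improvements_le_trans[OF A2 _ step u(1) weak] s by blast
  with u(1) \<phi>u show ?thesis
    unfolding L_def by blast
qed

theorem theorem2p7:
  fixes X :: "'a set" and \<eta> :: "'a \<Rightarrow> 'a \<Rightarrow> ennreal" and \<phi> :: "'a \<Rightarrow> ennreal" and x :: 'a
  assumes "X \<noteq> {}"
    and "A2 X \<eta>"
    and "A4 X \<eta>"
    and "x \<in> X"
    and "\<eta> x x < \<infinity>"
    and "0 < \<phi> x" and "\<phi> x < \<infinity>"
    and "\<And>(u :: 'a) (s :: nat \<Rightarrow> 'a). u \<in> X \<Longrightarrow> range s \<subseteq> X \<Longrightarrow>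
           (\<And>j k. j < k \<Longrightarrow> \<phi> (s k) < \<phi> (s j)) \<Longrightarrow>
           (\<lambda>k. \<eta> u (s k)) \<longlonglongrightarrow> 0 \<Longrightarrow> \<phi> u \<le> lim (\<lambda>k. \<phi> (s k))"
  shows "\<exists>u\<in>X. \<phi> u + \<eta> u x \<le> \<phi> x + \<eta> x x \<and> (\<forall>u'\<in>X. \<phi> u' + \<eta> u' u \<ge> \<phi> u)"
proof (rule ccontr)
  note A2 = \<open>A2 X \<eta>\<close> and A4 = \<open>A4 X \<eta>\<close> and xX = \<open>x \<in> X\<close> and lsc = assms(8)
  let ?I = "improvements X \<eta> \<phi>"
  assume contra: "\<not> ?thesis"
  \<comment> \<open>The term \<open>\<eta> x x\<close> on the right makes \<open>x\<close> itself
    admissible, so under \<open>contra\<close> both \<open>x\<close> and all its improvements can be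
    improved.\<close>
  have good: "\<phi> u + \<eta> u x \<le> \<phi> x + \<eta> x x" if "u = x \<or> u \<in> ?I x" for u
  proof -
    have "\<phi> x \<le> \<phi> x + \<eta> x x" by simp
    moreover have "\<phi> u + \<eta> u x < \<phi> x" if "u \<in> ?I x"
      using that by (simp add: improvements_def)
    ultimately show ?thesis
      using that by (meson less_imp_le order_trans order_refl)
  qed
  have improvable: "?I u \<noteq> {}" if "u = x \<or> u \<in> ?I x" for u
  proof -
    have "u \<in> X" using that xX by (auto simp: improvements_def)
    with contra good[OF that] show ?thesis
      by (auto simp: improvements_def not_le)
  qed
  \<comment> \<open>Dependent choice only guarantees \<open>P 0 (s 0)\<close>, so the starting point
    \<open>x\<close> is built into the invariant.\<close>
  define P where "P n u \<longleftrightarrow> (n = 0 \<longrightarrow> u = x) \<and> (u = x \<or> u \<in> ?I x)" for n :: nat and u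
  define Q where "Q n u w \<longleftrightarrow> w \<in> ?I u \<and> (\<forall>v\<in>?I u. \<phi> w \<le> \<phi> v + ennreal (inverse (real (Suc n))))"
    for n u w
  have "\<exists>w. P (Suc n) w \<and> Q n u w" if "P n u" for n u
  proof -
    have ux: "u = x \<or> u \<in> ?I x" using that by (simp add: P_def)
    then obtain v where v: "v \<in> ?I u" using improvable by blast
    \<comment> \<open>A value strictly below another is finite, which is what an almost minimal
      choice requires.\<close>
    have "\<phi> v < \<infinity>"
      using improvements_less[OF v] top_greatest by (simp add: less_le_trans)
    with v obtain w where "Q n u w"
      using exists_almost_minimizer[of v "?I u" \<phi> "ennreal (inverse (real (Suc n)))"]
      by (auto simp: Q_def)
    moreover from this have "w \<in> ?I x"
      using ux improvements_trans[OF A2 xX] by (auto simp: Q_def)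
    ultimately show ?thesis by (auto simp: P_def)
  qed
  moreover have "\<exists>u. P 0 u" by (simp add: P_def)
  ultimately obtain s where sP: "\<And>n. P n (s n)" and sQ: "\<And>n. Q n (s n) (s (Suc n))"
    using dependent_nat_choice[of P Q] by metis
  have s0: "s 0 = x" using sP[of 0] by (simp add: P_def)
  have sX: "range s \<subseteq> X"
  proof (rule image_subsetI)
    show "s n \<in> X" for n
      using sP[of n] xX by (auto simp: P_def improvements_def)
  qed
  have step: "s (Suc n) \<in> ?I (s n)" for n
    using sQ by (simp add: Q_def)
  have dec: "\<phi> (s k) < \<phi> (s j)" if "j < k" for j k
  proof (rule improvements_less[where \<phi> = \<phi>])
    show "s k \<in> ?I (s j)"
      using A2 sX step that by (rule improvements_chain)
  qed
  then have "decseq (\<lambda>k. \<phi> (s k))"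
    by (intro decseq_SucI less_imp_le) simp
  then have lim: "(\<lambda>k. \<phi> (s k)) \<longlonglongrightarrow> (INF k. \<phi> (s k))"
    by (rule LIMSEQ_INF)
  have "\<exists>u\<in>X. \<phi> u \<le> (INF k. \<phi> (s k)) \<and> (\<forall>k. u \<in> ?I (s k))"
  proof (rule improvements_chain_limit[where s = s, OF A2 A4 sX _ step])
    show "\<phi> (s 0) < \<infinity>" using s0 assms(7) by simp
    show "\<phi> v \<le> (INF k. \<phi> (s k))" if "v \<in> X" "(\<lambda>k. \<eta> v (s k)) \<longlonglongrightarrow> 0" for v
      using lsc[OF that(1) sX dec that(2)] limI[OF lim] by simp
  qed
  then obtain u where u: "u \<in> X" "\<phi> u \<le> (INF k. \<phi> (s k))" "\<And>k. u \<in> ?I (s k)"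
    by blast
  have "u \<in> ?I x" using u(3)[of 0] s0 by simp
  then obtain v where v: "v \<in> ?I u"
    using improvable by blast
  \<comment> \<open>By transitivity \<open>v\<close> competed in the choice of every
    \<open>s (Suc n)\<close>. As the slack 1/(n+1) vanishes, the infimum is at most
    \<open>\<phi> v\<close>, although \<open>\<phi> v\<close> < \<open>\<phi> u\<close> and
    \<open>\<phi> u\<close> is at most the infimum.\<close>
  have "\<phi> (s (Suc n)) \<le> \<phi> v + ennreal (inverse (real (Suc n)))" for n
    using sQ[of n] improvements_trans[OF A2 _ u(3)[of n] v] sX by (auto simp: Q_def)
  moreover have "(\<lambda>n. \<phi> v + ennreal (inverse (real (Suc n)))) \<longlonglongrightarrow> \<phi> v + ennreal 0"
    by (intro tendsto_add tendsto_const tendsto_ennrealI LIMSEQ_inverse_real_of_nat)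
  ultimately have "(INF k. \<phi> (s k)) \<le> \<phi> v + ennreal 0"
    using LIMSEQ_le[OF LIMSEQ_Suc[OF lim]] by blast
  with u(2) improvements_less[OF v] show False by simp
qed

end
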